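(* Let $Y$ be a $*$-admissible $*$-first-countable pointed Choquet space. For any topological space $X$ the following conditions are equivalent: (1) $C_k'(X,Y)$ is Choquet; (2) $X$ has WDMOP (the winning discrete moving off property); (3) $C_k'(X,2)$ is Choquet, where $2=\{0,1\}$ is the discrete two-point space with distinguished point $0$.
   Context: A point $x\in X$ is isolated if $\{x\}$ is clopen in $X$; $\dot X$ is the set of isolated points of $X$ and $X'=X\setminus\dot X$. A pointed space is a topological space $Y$ with a distinguished point $*_Y$; it is $*$-first-countable if $Y$ is first-countable at $*_Y$, and $*$-admissible if $*_Y$ has a neighborhood which is not dense in $Y$. $C_k(X,Y)$ is the space of continuous functions $X\to Y$ with the compact-open topology (subbase: $\{f:f(K)\subset U\}$, $K\subset X$ compact, $U\subset Y$ open), and $C_k'(X,Y)=\{f\in C_k(X,Y):f(X')\subset\{*_Y\}\}$ with the subspace topology. Choquet: in the game $\mathsf{G_{EN}}(Z)$ on a space $Z$, player $\mathsf E$ starts with a non-empty open $U_1$, player $\mathsf N$ answers with a non-empty open $V_1\subset U_1$, and at the $n$-th inning $\mathsf E$ chooses a non-empty open $U_n\subset V_{n-1}$ and $\mathsf N$ a non-empty open $V_n\subset U_n$; $\mathsf N$ wins iff $\bigcap_nU_n\neq\emptyset$. $Z$ is Choquet if $\mathsf N$ has a winning strategy. WDMOP: in the game $\mathsf{G_{KF}}(X)$, at the $n$-th inning player $\mathsf K$ (who starts) chooses a compact set $K_n\subset X$ and player $\mathsf F$ answers with a finite set $F_n\subset\dot X$ with $F_n\cap K_n=\emptyset$; $\mathsf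 K$ wins if the indexed family $\{F_n\}_n$ is discrete in $X$ (each point of $X$ has a neighborhood meeting $F_n$ for at most one $n$), otherwise $\mathsf F$ wins. $X$ has WDMOP if $\mathsf K$ has a winning strategy, i.e. a function $S$ assigning to each finite sequence $(F_0,\dots,F_{n-1})$ of finite subsets of $\dot X$ a compact set in $X$ such that $\{F_n\}_{n\in\omega}$ is discrete in $X$ whenever $F_n\cap S(F_0,\dots,F_{n-1})=\emptyset$ for all $n\in\omega$. *)

theory Defs
  imports "HOL-Analysis.Analysis"
begin

text \<open>
  Topological spaces are values of type \<^typ>\<open>'a topology\<close>, with no separation axioms and possibly
  with empty carrier.  A pointed space is a topology together with a point of its carrier.
\<close>

definition isolated_points :: "'a topology \<Rightarrow> 'a set" where
  "isolated_points X = {x \<in> topspace X. openin X {x} \<and> closedin X {x}}"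

definition nonisolated_points :: "'a topology \<Rightarrow> 'a set" where
  "nonisolated_points X = topspace X - isolated_points X"

text \<open>The condition of \<^const>\<open>first_countable\<close>, at a single point.\<close>

definition first_countable_at :: "'a topology \<Rightarrow> 'a \<Rightarrow> bool" where
  "first_countable_at Y y \<longleftrightarrow>
     (\<exists>B. countable B \<and> (\<forall>V\<in>B. openin Y V) \<and>
          (\<forall>U. openin Y U \<and> y \<in> U \<longrightarrow> (\<exists>V\<in>B. y \<in> V \<and> V \<subseteq> U)))"

definition star_admissible :: "'a topology \<Rightarrow> 'a \<Rightarrow> bool" where
  "star_admissible Y pt \<longleftrightarrow>
     (\<exists>N U. openin Y U \<and> pt \<in> U \<and> U \<subseteq> N \<and> N \<subseteq> topspace Y \<and> Y closure_of N \<noteq> topspace Y)"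

text \<open>
  Functions on the carrier of \<open>X\<close> are represented by functions that are \<^const>\<open>undefined\<close> outside
  it, as in \<^const>\<open>product_topology\<close>.
\<close>

definition continuous_functions :: "'a topology \<Rightarrow> 'b topology \<Rightarrow> ('a \<Rightarrow> 'b) set" where
  "continuous_functions X Y = {f \<in> extensional (topspace X). continuous_map X Y f}"

definition Ck :: "'a topology \<Rightarrow> 'b topology \<Rightarrow> ('a \<Rightarrow> 'b) topology" where
  "Ck X Y = topology_generated_by
     {{f \<in> continuous_functions X Y. f ` K \<subseteq> U} | K U. compactin X K \<and> openin Y U}"

definition Ck' :: "'a topology \<Rightarrow> 'b topology \<Rightarrow> 'b \<Rightarrow> ('a \<Rightarrow> 'b) topology" where
  "Ck' X Y pt = subtopology (Ck X Y)
     {f \<in> continuous_functions X Y. f ` nonisolated_points X \<subseteq> {pt}}"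

lemma topspace_Ck: "topspace (Ck X Y) = continuous_functions X Y"
proof -
  have "continuous_functions X Y \<in>
      {{f \<in> continuous_functions X Y. f ` K \<subseteq> U} | K U. compactin X K \<and> openin Y U}"
    by (auto intro!: exI[of _ "{}"])
  then show ?thesis
    unfolding Ck_def by (auto simp: topology_generated_by_topspace)
qed

text \<open>
  A strategy \<open>\<sigma>\<close> of player N maps the non-empty list of all previous moves of E to the answer of N
  (the earlier answers of N being determined by \<open>\<sigma>\<close>).  \<open>EN_position Z \<sigma> us\<close> says that \<open>us\<close> is the
  list of moves of E in a finite initial part of a play in which E obeys the rules and N follows \<open>\<sigma>\<close>.
\<close>

definition EN_position :: "'a topology \<Rightarrow> ('a set list \<Rightarrow> 'a set) \<Rightarrow> 'a set list \<Rightarrow> bool" where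
  "EN_position Z \<sigma> us \<longleftrightarrow>
     (\<forall>i<length us. openin Z (us ! i) \<and> us ! i \<noteq> {} \<and> (0 < i \<longrightarrow> us ! i \<subseteq> \<sigma> (take i us)))"

definition EN_winning_strategy_N :: "'a topology \<Rightarrow> ('a set list \<Rightarrow> 'a set) \<Rightarrow> bool" where
  "EN_winning_strategy_N Z \<sigma> \<longleftrightarrow>
     (\<forall>us. us \<noteq> [] \<and> EN_position Z \<sigma> us \<longrightarrow>
        openin Z (\<sigma> us) \<and> \<sigma> us \<noteq> {} \<and> \<sigma> us \<subseteq> last us) \<and>
     (\<forall>U :: nat \<Rightarrow> 'a set. (\<forall>n. EN_position Z \<sigma> (map U [0..<n])) \<longrightarrow> (\<Inter>n. U n) \<noteq> {})"

definition Choquet_space :: "'a topology \<Rightarrow> bool" where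
  "Choquet_space Z \<longleftrightarrow> (\<exists>\<sigma>. EN_winning_strategy_N Z \<sigma>)"

text \<open>Discreteness of an indexed family: equal non-empty members with different indices count twice.\<close>

definition discrete_family :: "'a topology \<Rightarrow> (nat \<Rightarrow> 'a set) \<Rightarrow> bool" where
  "discrete_family X F \<longleftrightarrow>
     (\<forall>x\<in>topspace X. \<exists>V. openin X V \<and> x \<in> V \<and>
        (\<forall>m n. V \<inter> F m \<noteq> {} \<and> V \<inter> F n \<noteq> {} \<longrightarrow> m = n))"

definition KF_winning_strategy_K :: "'a topology \<Rightarrow> ('a set list \<Rightarrow> 'a set) \<Rightarrow> bool" where
  "KF_winning_strategy_K X S \<longleftrightarrow>
     (\<forall>Fs. (\<forall>F\<in>set Fs. finite F \<and> F \<subseteq> isolated_points X) \<longrightarrow> compactin X (S Fs)) \<and>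
     (\<forall>F :: nat \<Rightarrow> 'a set.
        (\<forall>n. finite (F n) \<and> F n \<subseteq> isolated_points X \<and> F n \<inter> S (map F [0..<n]) = {}) \<longrightarrow>
        discrete_family X F)"

definition WDMOP :: "'a topology \<Rightarrow> bool" where
  "WDMOP X \<longleftrightarrow> (\<exists>S. KF_winning_strategy_K X S)"

end

theory Submission
  imports Defs
begin

text \<open>
  If N wins the Choquet game on \<open>C\<^sub>k'(X,Y)\<close>, then K lets E play the answer of N intersected with
  \<open>{f. f ` F\<^sub>n \<subseteq> W}\<close>, where \<open>W\<close> is a non-empty open set missing a neighbourhood \<open>A\<close> of the base
  point, and chooses a compact set off which some member of N's answer can be modified without
  leaving that answer. A function \<open>f\<close> surviving the play separates every non-isolated point from all \<open>F\<^sub>n\<close> by the open set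
  \<open>f -` A\<close>.

  Conversely, N shrinks the moves of E to sets of functions that satisfy conditions at a finite set
  \<open>D\<^sub>n\<close> of isolated points and map the rest of a compact set \<open>K\<^sub>n\<close> into a small neighbourhood \<open>G\<^sub>n\<close>
  of the base point. At each point of \<open>D\<^sub>n\<close> a separate Choquet game is played in \<open>Y\<close>, and \<open>K\<^sub>n\<close>
  contains the answer of K to \<open>F\<^sub>0, \<dots>, F\<^sub>n\<^sub>-\<^sub>1\<close>, where \<open>F\<^sub>n = D\<^sub>n\<^sub>+\<^sub>1 - (D\<^sub>n \<union> K\<^sub>n)\<close>. The points entering
  \<open>D\<^sub>n\<^sub>+\<^sub>1\<close> inside \<open>K\<^sub>n\<close> are sent into \<open>G\<^sub>n\<close>, and those outside form a discrete family, so the limit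
  function is continuous.
\<close>

section \<open>Isolated points and the elements of the function space\<close>

lemma topspace_Ck':
  "topspace (Ck' X Y pt) = {f \<in> continuous_functions X Y. f ` nonisolated_points X \<subseteq> {pt}}"
  by (auto simp: Ck'_def topspace_Ck)

lemma isolated_pointsD:
  assumes "x \<in> isolated_points X"
  shows "x \<in> topspace X" "openin X {x}" "closedin X {x}"
  using assms by (auto simp: isolated_points_def)

lemma openin_isolated:
  assumes "F \<subseteq> isolated_points X"
  shows "openin X F"
proof -
  have "openin X (\<Union>x\<in>F. {x})" using assms by (intro openin_Union) (auto dest: isolated_pointsD)
  then show ?thesis by simp
qed

lemma closedin_finite_isolated:
  assumes "finite F" "F \<subseteq> isolated_points X"
  shows "closedin X F"
proof -
  have "closedin X (\<Union>x\<in>F. {x})"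
    using assms by (intro closedin_Union) (auto dest: isolated_pointsD)
  then show ?thesis by simp
qed

lemma finite_compactin_isolated:
  assumes "compactin X K" "K \<subseteq> isolated_points X"
  shows "finite K"
proof -
  have "\<exists>\<F>. finite \<F> \<and> \<F> \<subseteq> (\<lambda>x. {x}) ` K \<and> K \<subseteq> \<Union>\<F>"
    using assms by (intro compactinD[of X]) (auto dest: isolated_pointsD)
  then obtain \<F> where \<F>: "finite \<F>" "\<F> \<subseteq> (\<lambda>x. {x}) ` K" "K \<subseteq> \<Union>\<F>" by blast
  then have "finite (\<Union>\<F>)" by (intro finite_Union) auto
  with \<F>(3) show ?thesis by (rule finite_subset)
qed

text \<open>Isolated points have open singletons, so continuity needs checking only at non-isolated
  points, where the value is \<open>pt\<close>.\<close>

lemma topspace_Ck'I: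
  assumes "f \<in> extensional (topspace X)" "\<And>x. x \<in> topspace X \<Longrightarrow> f x \<in> topspace Y"
    and "\<And>x. x \<in> nonisolated_points X \<Longrightarrow> f x = pt"
    and nb: "\<And>x W. x \<in> nonisolated_points X \<Longrightarrow> openin Y W \<Longrightarrow> pt \<in> W \<Longrightarrow>
      \<exists>V. openin X V \<and> x \<in> V \<and> (\<forall>y\<in>V. f y \<in> W)"
  shows "f \<in> topspace (Ck' X Y pt)"
proof -
  have "openin X {x \<in> topspace X. f x \<in> W}" if W: "openin Y W" for W
  proof (subst openin_subopen, safe)
    fix x assume x: "x \<in> topspace X" "f x \<in> W"
    show "\<exists>T. openin X T \<and> x \<in> T \<and> T \<subseteq> {x \<in> topspace X. f x \<in> W}"
    proof (cases "x \<in> isolated_points X")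
      case True
      then show ?thesis using x by (intro exI[of _ "{x}"]) (auto dest: isolated_pointsD)
    next
      case False
      then have xn: "x \<in> nonisolated_points X" using x by (simp add: nonisolated_points_def)
      with assms(3) x have "pt \<in> W" by metis
      from nb[OF xn W this] obtain V where "openin X V" "x \<in> V" "\<forall>y\<in>V. f y \<in> W" by blast
      then show ?thesis using openin_subset by blast
    qed
  qed
  then have "continuous_map X Y f" using assms(2) by (auto simp: continuous_map_def)
  then show ?thesis using assms(1,3) by (auto simp: topspace_Ck' continuous_functions_def)
qed

lemma topspace_Ck'D:
  assumes "f \<in> topspace (Ck' X Y pt)"
  shows "f \<in> extensional (topspace X)" "continuous_map X Y f"
    "\<And>x. x \<in> topspace X \<Longrightarrow> f x \<in> topspace Y"
    "\<And>x. x \<in> nonisolated_points X \<Longrightarrow> f x = pt"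
    "\<And>x. x \<in> topspace X \<Longrightarrow> f x \<noteq> pt \<Longrightarrow> x \<in> isolated_points X"
  using assms continuous_map_image_subset_topspace[of X Y f]
  by (auto simp: topspace_Ck' continuous_functions_def nonisolated_points_def)

lemma const_in_topspace_Ck':
  assumes "pt \<in> topspace Y"
  shows "(\<lambda>x\<in>topspace X. pt) \<in> topspace (Ck' X Y pt)"
  using assms
  by (intro topspace_Ck'I) (auto simp: nonisolated_points_def intro!: exI[of _ "topspace X"])

text \<open>Finite sets of isolated points are closed, so deleting \<open>F\<close> from a
  neighbourhood of a non-isolated point leaves a neighbourhood on which \<open>f\<close> is
  unchanged.\<close>

lemma modify_in_topspace_Ck':
  assumes f: "f \<in> topspace (Ck' X Y pt)" and F: "finite F" "F \<subseteq> isolated_points X"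
    and e: "\<And>x. x \<in> F \<Longrightarrow> e x \<in> topspace Y"
  shows "(\<lambda>x. if x \<in> F then e x else f x) \<in> topspace (Ck' X Y pt)"
proof (rule topspace_Ck'I)
  show "(\<lambda>x. if x \<in> F then e x else f x) \<in> extensional (topspace X)"
    using topspace_Ck'D(1)[OF f] F(2) by (auto simp: extensional_def isolated_points_def)
next
  fix x W assume x: "x \<in> nonisolated_points X" and W: "openin Y W" "pt \<in> W"
  have "openin X ({x \<in> topspace X. f x \<in> W} - F)"
    using topspace_Ck'D(2)[OF f] W F
    by (intro openin_diff openin_continuous_map_preimage[where Y = Y] closedin_finite_isolated)
  moreover have "x \<in> {x \<in> topspace X. f x \<in> W} - F"
    using x W F topspace_Ck'D(4)[OF f x] by (auto simp: nonisolated_points_def)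
  ultimately show "\<exists>V. openin X V \<and> x \<in> V \<and> (\<forall>y\<in>V. (if y \<in> F then e y else f y) \<in> W)"
    by (intro exI[of _ "{x \<in> topspace X. f x \<in> W} - F"]) auto
qed (use F e topspace_Ck'D(3,4)[OF f] in \<open>auto simp: nonisolated_points_def\<close>)

section \<open>Basic neighbourhoods in the function space\<close>

lemma openin_Ck'_subbasic:
  assumes "compactin X K" "openin Y U"
  shows "openin (Ck' X Y pt) {f \<in> topspace (Ck' X Y pt). f ` K \<subseteq> U}"
proof -
  have "openin (Ck X Y) {f \<in> continuous_functions X Y. f ` K \<subseteq> U}"
    unfolding Ck_def using assms by (intro topology_generated_by_Basis) blast
  then have "openin (Ck' X Y pt) ({f \<in> continuous_functions X Y. f ` K \<subseteq> U} \<inter>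
      {f \<in> continuous_functions X Y. f ` nonisolated_points X \<subseteq> {pt}})"
    unfolding Ck'_def by (auto simp: openin_subtopology)
  also have "{f \<in> continuous_functions X Y. f ` K \<subseteq> U} \<inter>
      {f \<in> continuous_functions X Y. f ` nonisolated_points X \<subseteq> {pt}} =
      {f \<in> topspace (Ck' X Y pt). f ` K \<subseteq> U}"
    by (auto simp: topspace_Ck')
  finally show ?thesis .
qed

text \<open>
  The set \<open>D\<close> collects the finitely many points of \<open>K\<close> at which a neighbourhood of \<open>f\<close> may demand
  values far from the base point. Compact subsets of \<open>X\<close> mapped into an open set without \<open>pt\<close> consist
  of isolated points, hence are finite; this is why such a \<open>D\<close> always exists.
\<close>

definition is_box ::
  "'a topology \<Rightarrow> 'b topology \<Rightarrow> 'b \<Rightarrow> ('a \<Rightarrow> 'b) \<Rightarrow> ('a \<Rightarrow> 'b) set \<Rightarrow> 'a set \<Rightarrow> 'b set \<Rightarrow>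
    'a set \<Rightarrow> ('a \<Rightarrow> 'b set) \<Rightarrow> bool" where
  "is_box X Y pt f U K G D W \<longleftrightarrow>
     compactin X K \<and> openin Y G \<and> pt \<in> G \<and> finite D \<and> D \<subseteq> isolated_points X \<and>
     (\<forall>x\<in>topspace X. openin Y (W x) \<and> f x \<in> W x \<and> (x \<notin> D \<longrightarrow> G \<subseteq> W x)) \<and>
     (\<forall>g\<in>topspace (Ck' X Y pt). (\<forall>x\<in>K. g x \<in> W x) \<longrightarrow> g \<in> U)"

text \<open>Induction on the generation of \<open>U\<close> from the subbase. Two boxes merge by
  uniting \<open>K\<close> and \<open>D\<close> and intersecting \<open>G\<close> and
  \<open>W\<close>; a union inherits the box of a member containing \<open>f\<close>; a subbasic set
  with \<open>pt\<close> in \<open>V\<close> takes \<open>V\<close> as its bound.\<close>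

lemma box_nhd_Ck:
  assumes pt: "pt \<in> topspace Y" and U: "openin (Ck X Y) U"
    and f: "f \<in> U" "f \<in> topspace (Ck' X Y pt)"
  shows "\<exists>K G D W. is_box X Y pt f U K G D W"
proof -
  have "generate_topology_on {{f \<in> continuous_functions X Y. f ` K \<subseteq> U} | K U.
      compactin X K \<and> openin Y U} U"
    using U unfolding Ck_def by (simp add: openin_topology_generated_by_iff)
  then show ?thesis using f(1)
  proof induction
    case (Int A B)
    then obtain K G D W K' G' D' W' where
      "is_box X Y pt f A K G D W" "is_box X Y pt f B K' G' D' W'" by blast
    then have "is_box X Y pt f (A \<inter> B) (K \<union> K') (G \<inter> G') (D \<union> D') (\<lambda>x. W x \<inter> W' x)"
      by (auto simp: is_box_def compactin_Un)
    then show ?case by blast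
  next
    case (UN \<A>)
    then obtain A K G D W where "A \<in> \<A>" "is_box X Y pt f A K G D W" by blast
    then have "is_box X Y pt f (\<Union>\<A>) K G D W" by (auto simp: is_box_def)
    then show ?case by blast
  next
    case (Basis B)
    then obtain K V where B: "B = {f \<in> continuous_functions X Y. f ` K \<subseteq> V}"
      and KV: "compactin X K" "openin Y V" by blast
    have fK: "f ` K \<subseteq> V" using Basis.prems B by blast
    have KX: "K \<subseteq> topspace X" using KV(1) compactin_subset_topspace by blast
    let ?W = "\<lambda>x. if x \<in> K then V else topspace Y"
    have W: "openin Y (?W x)" "f x \<in> ?W x" if "x \<in> topspace X" for x
      using fK KV topspace_Ck'D(3)[OF f(2) that] by auto
    show ?case
    proof (cases "pt \<in> V")
      case True
      then have "is_box X Y pt f B K V {} ?W"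
        using KV W openin_subset[OF KV(2)] by (auto simp: is_box_def B topspace_Ck')
      then show ?thesis by blast
    next
      case False
      have "K \<subseteq> isolated_points X"
      proof
        fix x assume "x \<in> K"
        then show "x \<in> isolated_points X"
          using fK False KX topspace_Ck'D(5)[OF f(2), of x] by blast
      qed
      moreover from this have "finite K" using KV(1) finite_compactin_isolated by blast
      \<comment> \<open>Since \<open>D\<close> is all of \<open>K\<close>, the bound matters only
        where \<open>?W\<close> is the whole carrier.\<close>
      ultimately have "is_box X Y pt f B K (topspace Y) K ?W"
        using KV W pt by (auto simp: is_box_def B topspace_Ck')
      then show ?thesis by blast
    qed
  qed auto
qed

lemma box_nhd:
  assumes "pt \<in> topspace Y" "openin (Ck' X Y pt) U" "f \<in> U"
  shows "\<exists>K G D W. is_box X Y pt f U K G D W"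
proof -
  obtain T where T: "openin (Ck X Y) T"
    and U: "U = T \<inter> {f \<in> continuous_functions X Y. f ` nonisolated_points X \<subseteq> {pt}}"
    using assms(2) unfolding Ck'_def openin_subtopology by blast
  have "f \<in> topspace (Ck' X Y pt)" using openin_subset[OF assms(2)] assms(3) by blast
  moreover have "f \<in> T" using assms(3) U by simp
  ultimately obtain K G D W where "is_box X Y pt f T K G D W"
    using box_nhd_Ck[OF assms(1) T] by metis
  then have "is_box X Y pt f U K G D W" by (auto simp: is_box_def U topspace_Ck')
  then show ?thesis by blast
qed

section \<open>Choquet strategies with memory\<close>

lemma EN_position_Nil [simp]: "EN_position Z \<sigma> []"
  by (simp add: EN_position_def)

lemma EN_position_snoc:
  "EN_position Z \<sigma> (us @ [u]) \<longleftrightarrow>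
     EN_position Z \<sigma> us \<and> openin Z u \<and> u \<noteq> {} \<and> (us \<noteq> [] \<longrightarrow> u \<subseteq> \<sigma> us)"
  by (auto simp: EN_position_def nth_append less_Suc_eq)

text \<open>N may play from a state instead of the raw list of moves: the strategy folds a chosen
  successor function over the list and answers \<open>V\<close> of the resulting state.
  \<open>V s0\<close> has to contain the carrier because the first move of E is
  unrestricted.\<close>

lemma Choquet_spaceI_states:
  fixes V :: "'s \<Rightarrow> 'a set" and R :: "'s \<Rightarrow> 'a set \<Rightarrow> 's \<Rightarrow> bool"
  assumes init: "I s0" "topspace Z \<subseteq> V s0"
    and step: "\<And>s U. I s \<Longrightarrow> openin Z U \<Longrightarrow> U \<noteq> {} \<Longrightarrow> U \<subseteq> V s \<Longrightarrow> \<exists>s'. R s U s'"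
    and R: "\<And>s U s'. I s \<Longrightarrow> R s U s' \<Longrightarrow> I s' \<and> openin Z (V s') \<and> V s' \<noteq> {} \<and> V s' \<subseteq> U"
    and win: "\<And>s U. s 0 = s0 \<Longrightarrow> (\<And>n. I (s n)) \<Longrightarrow> (\<And>n. R (s n) (U n) (s (Suc n))) \<Longrightarrow>
      (\<Inter>n::nat. U n) \<noteq> {}"
  shows "Choquet_space Z"
proof -
  define next_state where "next_state s U = (SOME s'. R s U s')" for s U
  define st where "st us = foldl next_state s0 us" for us
  define \<sigma> where "\<sigma> us = V (st us)" for us
  have st_snoc: "st (us @ [u]) = next_state (st us) u" for us u by (simp add: st_def)
  \<comment> \<open>The invariant is a hypothesis here; the induction that discharges it uses this
    fact.\<close>
  have move': "R (st us) u (st (us @ [u]))"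
    if "I (st us)" "EN_position Z \<sigma> (us @ [u])" for us u
  proof -
    have u: "openin Z u" "u \<noteq> {}" "us \<noteq> [] \<longrightarrow> u \<subseteq> \<sigma> us"
      using that(2) by (auto simp: EN_position_snoc)
    have "u \<subseteq> V (st us)"
      using u init openin_subset[OF u(1)] by (cases "us = []") (auto simp: st_def \<sigma>_def)
    from step[OF that(1) u(1,2) this] show ?thesis
      unfolding st_snoc next_state_def by (rule someI_ex)
  qed
  have st: "I (st us)" if "EN_position Z \<sigma> us" for us
    using that
  proof (induction us rule: rev_induct)
    case Nil
    then show ?case using init by (simp add: st_def)
  next
    case (snoc u us)
    then have "I (st us)" by (simp add: EN_position_snoc)
    then show ?case using move' R snoc.prems by blast
  qed
  have move: "R (st us) u (st (us @ [u]))" if "EN_position Z \<sigma> (us @ [u])" for us u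
    using move' st that by (simp add: EN_position_snoc)
  have "EN_winning_strategy_N Z \<sigma>"
    unfolding EN_winning_strategy_N_def
  proof (intro conjI allI impI; (elim conjE)?)
    fix us assume "us \<noteq> []" and pos: "EN_position Z \<sigma> us"
    then obtain vs v where us: "us = vs @ [v]" by (metis rev_exhaust)
    have "I (st vs)" using pos st by (simp add: us EN_position_snoc)
    from R[OF this move[OF pos[unfolded us]]]
    show "openin Z (\<sigma> us)" "\<sigma> us \<noteq> {}" "\<sigma> us \<subseteq> last us" by (simp_all add: us \<sigma>_def)
  next
    fix U :: "nat \<Rightarrow> 'a set" assume pos: "\<forall>n. EN_position Z \<sigma> (map U [0..<n])"
    show "(\<Inter>n. U n) \<noteq> {}"
    proof (rule win[of "\<lambda>n. st (map U [0..<n])"])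
      show "st (map U [0..<0]) = s0" by (simp add: st_def)
      show "I (st (map U [0..<n]))" for n using pos st by blast
      show "R (st (map U [0..<n])) (U n) (st (map U [0..<Suc n]))" for n
        using move pos[rule_format, of "Suc n"] by simp
    qed
  qed
  then show ?thesis by (auto simp: Choquet_space_def)
qed

section \<open>From a Choquet function space to WDMOP\<close>

lemma WDMOP_if_Choquet_Ck':
  fixes X :: "'a topology" and Y :: "'b topology"
  assumes pt: "pt \<in> topspace Y" and adm: "star_admissible Y pt"
    and Ch: "Choquet_space (Ck' X Y pt)"
  shows "WDMOP X"
proof -
  let ?C = "topspace (Ck' X Y pt)"
  obtain A W where A: "openin Y A" "pt \<in> A" and W: "openin Y W" "W \<noteq> {}" "A \<inter> W = {}"
  proof -
    obtain N A where NA: "openin Y A" "pt \<in> A" "A \<subseteq> N" "N \<subseteq> topspace Y"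
      "Y closure_of N \<noteq> topspace Y"
      using adm unfolding star_admissible_def by blast
    have "openin Y (topspace Y - Y closure_of N)" by (intro openin_diff) auto
    moreover have "topspace Y - Y closure_of N \<noteq> {}"
      using NA(5) closure_of_subset_topspace[of Y N] by blast
    moreover have "A \<inter> (topspace Y - Y closure_of N) = {}"
      using NA(3) closure_of_subset[OF NA(4)] by blast
    ultimately show thesis using that NA by blast
  qed
  obtain w where w: "w \<in> W" using W by blast
  have wY: "w \<in> topspace Y" using w W openin_subset by blast
  obtain \<sigma> where \<sigma>: "EN_winning_strategy_N (Ck' X Y pt) \<sigma>"
    using Ch by (auto simp: Choquet_space_def)
  \<comment> \<open>K must answer with a compact set even after illegal moves of F, so
    \<open>supp V\<close> is compact for every \<open>V\<close>; the empty set serves when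
    \<open>V\<close> is not open or is empty.\<close>
  define supp where "supp V = (SOME K. compactin X K \<and>
    (openin (Ck' X Y pt) V \<and> V \<noteq> {} \<longrightarrow>
      (\<exists>f\<in>V. \<forall>g\<in>?C. (\<forall>x\<in>K. g x = f x) \<longrightarrow> g \<in> V)))" for V
  have supp: "compactin X (supp V) \<and> (openin (Ck' X Y pt) V \<and> V \<noteq> {} \<longrightarrow>
      (\<exists>f\<in>V. \<forall>g\<in>?C. (\<forall>x\<in>supp V. g x = f x) \<longrightarrow> g \<in> V))" for V
    unfolding supp_def
  proof (rule someI_ex, cases "openin (Ck' X Y pt) V \<and> V \<noteq> {}")
    case True
    then obtain f where f: "f \<in> V" by blast
    from True f obtain K G D B where box: "is_box X Y pt f V K G D B"
      using box_nhd[OF pt] by blast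
    then have "K \<subseteq> topspace X" by (simp add: is_box_def compactin_subset_topspace)
    then have "\<forall>x\<in>K. f x \<in> B x" using box by (auto simp: is_box_def)
    then have "\<forall>g\<in>?C. (\<forall>x\<in>K. g x = f x) \<longrightarrow> g \<in> V" using box by (simp add: is_box_def)
    then show "\<exists>K. compactin X K \<and> (openin (Ck' X Y pt) V \<and> V \<noteq> {} \<longrightarrow>
      (\<exists>f\<in>V. \<forall>g\<in>?C. (\<forall>x\<in>K. g x = f x) \<longrightarrow> g \<in> V))"
      using f box by (auto simp: is_box_def)
  qed (auto intro: exI[of _ "{}"])
  \<comment> \<open>The simulated E opens with the whole space, so \<open>n\<close> finite sets give
    \<open>n + 1\<close> moves of E.\<close>
  define E where "E Fs = foldl (\<lambda>us F. us @ [\<sigma> us \<inter> {f \<in> ?C. f ` F \<subseteq> W}]) [?C] Fs" for Fs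
  \<comment> \<open>Including the earlier sets makes the \<open>F n\<close> pairwise disjoint, which
    gives discreteness at isolated points.\<close>
  define S where "S Fs = \<Union>(set Fs) \<union> supp (\<sigma> (E Fs))" for Fs
  have "KF_winning_strategy_K X S"
    unfolding KF_winning_strategy_K_def
  proof (intro conjI allI impI)
    fix Fs :: "'a set list" assume "\<forall>F\<in>set Fs. finite F \<and> F \<subseteq> isolated_points X"
    then have "compactin X (\<Union>(set Fs))"
      by (intro finite_imp_compactin) (auto dest: isolated_pointsD)
    then show "compactin X (S Fs)" using supp by (auto simp: S_def compactin_Un)
  next
    fix F :: "nat \<Rightarrow> 'a set"
    assume F: "\<forall>n. finite (F n) \<and> F n \<subseteq> isolated_points X \<and> F n \<inter> S (map F [0..<n]) = {}"
    define us where "us n = E (map F [0..<n])" for n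
    define U where "U n = last (us n)" for n
    have us0: "us 0 = [?C]" by (simp add: us_def E_def)
    have usS: "us (Suc n) = us n @ [\<sigma> (us n) \<inter> {f \<in> ?C. f ` F n \<subseteq> W}]" for n
      by (simp add: us_def E_def)
    have U: "map U [0..<Suc n] = us n" for n
    proof (induction n)
      case 0
      then show ?case by (simp add: U_def us0)
    next
      case (Suc n)
      have "map U [0..<Suc (Suc n)] = map U [0..<Suc n] @ [U (Suc n)]" by simp
      also have "\<dots> = us (Suc n)" unfolding Suc by (simp add: U_def usS)
      finally show ?case .
    qed
    have ne: "us n \<noteq> []" for n using U[of n] by auto
    have pos: "EN_position (Ck' X Y pt) \<sigma> (us n)" for n
    proof (induction n)
      case 0
      have "?C \<noteq> {}" using const_in_topspace_Ck'[OF pt, of X] by blast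
      then show ?case using EN_position_snoc[of "Ck' X Y pt" \<sigma> "[]" ?C] by (simp add: us0)
    next
      case (Suc n)
      let ?V = "\<sigma> (us n)"
      have V: "openin (Ck' X Y pt) ?V" "?V \<noteq> {}"
        using \<sigma> Suc ne unfolding EN_winning_strategy_N_def by blast+
      then obtain f where f: "f \<in> ?V" and
        agree: "\<And>g. g \<in> ?C \<Longrightarrow> (\<forall>x\<in>supp ?V. g x = f x) \<Longrightarrow> g \<in> ?V"
        using supp[of ?V] by blast
      have fC: "f \<in> ?C" using f V(1) openin_subset by blast
      \<comment> \<open>\<open>F n\<close> misses \<open>supp ?V\<close>, so this change of
        \<open>f\<close> stays inside the answer of N and the next move of E is non-empty.\<close>
      let ?g = "\<lambda>x. if x \<in> F n then w else f x"
      have gC: "?g \<in> ?C" using F wY by (intro modify_in_topspace_Ck'[OF fC]) auto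
      have "F n \<inter> supp ?V = {}" using F[rule_format, of n] by (auto simp: S_def us_def)
      then have "?g \<in> ?V" by (intro agree[OF gC]) auto
      moreover have "?g ` F n \<subseteq> W" using w by auto
      ultimately have "?V \<inter> {f \<in> ?C. f ` F n \<subseteq> W} \<noteq> {}" using gC by blast
      moreover have "openin (Ck' X Y pt) {f \<in> ?C. f ` F n \<subseteq> W}"
        using F W by (intro openin_Ck'_subbasic finite_imp_compactin) (auto dest: isolated_pointsD)
      ultimately show ?case using Suc V(1) by (auto simp: usS EN_position_snoc)
    qed
    have "EN_position (Ck' X Y pt) \<sigma> (map U [0..<n])" for n
      using pos U by (cases n) (simp, metis)
    then have "(\<Inter>n. U n) \<noteq> {}" using \<sigma> unfolding EN_winning_strategy_N_def by blast
    then obtain f where f: "\<And>n. f \<in> U n" by blast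
    have fC: "f \<in> ?C" using f[of 0] by (simp add: U_def us0)
    have fW: "f ` F n \<subseteq> W" for n using f[of "Suc n"] by (simp add: U_def usS)
    have disj: "F m \<inter> F n = {}" if "m < n" for m n
    proof -
      have "F m \<subseteq> S (map F [0..<n])" using that by (auto simp: S_def)
      then show ?thesis using F by blast
    qed
    show "discrete_family X F"
      unfolding discrete_family_def
    proof
      fix x assume x: "x \<in> topspace X"
      show "\<exists>V. openin X V \<and> x \<in> V \<and> (\<forall>m n. V \<inter> F m \<noteq> {} \<and> V \<inter> F n \<noteq> {} \<longrightarrow> m = n)"
      proof (cases "x \<in> isolated_points X")
        case True
        then show ?thesis using disj
          by (intro exI[of _ "{x}"]) (auto dest: isolated_pointsD, metis disjoint_iff linorder_cases)
      next
        case False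
        then have "f x = pt"
          using topspace_Ck'D(4)[OF fC] x by (simp add: nonisolated_points_def)
        moreover have "openin X {y \<in> topspace X. f y \<in> A}"
          using topspace_Ck'D(2)[OF fC] A by (intro openin_continuous_map_preimage[where Y = Y])
        moreover have "{y \<in> topspace X. f y \<in> A} \<inter> F n = {}" for n using fW[of n] W(3) by blast
        ultimately show ?thesis using x A
          by (intro exI[of _ "{y \<in> topspace X. f y \<in> A}"]) auto
      qed
    qed
  qed
  then show ?thesis by (auto simp: WDMOP_def)
qed

section \<open>From WDMOP to a Choquet function space: states and moves of N\<close>

text \<open>Finite intersections of an enumerated local base decrease, so all late members lie in a
  given neighbourhood.\<close>

lemma first_countable_at_sequence:
  assumes "first_countable_at Y y" "y \<in> topspace Y"
  shows "\<exists>A :: nat \<Rightarrow> 'a set. (\<forall>n. openin Y (A n) \<and> y \<in> A n) \<and>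
    (\<forall>U. openin Y U \<and> y \<in> U \<longrightarrow> (\<exists>n. \<forall>m\<ge>n. A m \<subseteq> U))"
proof -
  obtain B where B: "countable B" "\<And>V. V \<in> B \<Longrightarrow> openin Y V"
    "\<And>U. openin Y U \<Longrightarrow> y \<in> U \<Longrightarrow> \<exists>V\<in>B. y \<in> V \<and> V \<subseteq> U"
    using assms(1) unfolding first_countable_at_def by metis
  define B' where "B' = {V \<in> B. y \<in> V}"
  have ne: "B' \<noteq> {}" using B(3)[of "topspace Y"] assms(2) by (auto simp: B'_def)
  have cB': "countable B'" using B(1) by (simp add: B'_def)
  define A where "A n = (\<Inter>i\<le>n. from_nat_into B' i)" for n
  have "openin Y (A n)" for n
    unfolding A_def using from_nat_into[OF ne] B(2) by (intro openin_Inter) (auto simp: B'_def)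
  moreover have "y \<in> A n" for n
    unfolding A_def using from_nat_into[OF ne] by (auto simp: B'_def)
  moreover have "\<exists>n. \<forall>m\<ge>n. A m \<subseteq> U" if U: "openin Y U" "y \<in> U" for U
  proof -
    obtain V where V: "V \<in> B'" "V \<subseteq> U" using B(3)[OF U] by (auto simp: B'_def)
    then obtain n where "from_nat_into B' n = V" using from_nat_into_surj[OF cB'] by blast
    then have "\<forall>m\<ge>n. A m \<subseteq> U" using V by (auto simp: A_def)
    then show ?thesis ..
  qed
  ultimately show ?thesis by blast
qed

text \<open>
  What N remembers: in the notation above \<open>cpt\<close>, \<open>pts\<close>, \<open>bound\<close>, \<open>fins\<close> are \<open>K\<^sub>n\<close>, \<open>D\<^sub>n\<close>, \<open>G\<^sub>n\<close> and
  \<open>F\<^sub>0, \<dots>, F\<^sub>n\<^sub>-\<^sub>1\<close>, and \<open>hist x\<close> lists the moves of E so far in the game in \<open>Y\<close> played at \<open>x\<close>.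
\<close>

record ('a, 'b) state =
  cpt :: "'a set"
  pts :: "'a set"
  bound :: "'b set"
  hist :: "'a \<Rightarrow> 'b set list"
  fins :: "'a set list"

definition answer ::
  "'a topology \<Rightarrow> 'b topology \<Rightarrow> 'b \<Rightarrow> ('b set list \<Rightarrow> 'b set) \<Rightarrow> ('a, 'b) state \<Rightarrow> ('a \<Rightarrow> 'b) set" where
  "answer X Y pt \<tau> s = {g \<in> topspace (Ck' X Y pt).
     g ` (cpt s - pts s) \<subseteq> bound s \<and> (\<forall>x\<in>pts s. g x \<in> \<tau> (hist s x))}"

text \<open>The game in \<open>Y\<close> at \<open>x\<close> begins when \<open>x\<close> enters
  \<open>pts\<close>, so histories elsewhere are empty. Having \<open>S (fins s)\<close> inside
  \<open>cpt s\<close> makes the next finite set, taken off \<open>cpt s\<close>, a legal answer to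
  K.\<close>

definition good_state ::
  "'a topology \<Rightarrow> 'b topology \<Rightarrow> 'b \<Rightarrow> ('b set list \<Rightarrow> 'b set) \<Rightarrow> ('a set list \<Rightarrow> 'a set) \<Rightarrow>
    ('a, 'b) state \<Rightarrow> bool" where
  "good_state X Y pt \<tau> S s \<longleftrightarrow>
     compactin X (cpt s) \<and> finite (pts s) \<and> pts s \<subseteq> isolated_points X \<and>
     openin Y (bound s) \<and> pt \<in> bound s \<and>
     (\<forall>x. EN_position Y \<tau> (hist s x)) \<and> (\<forall>x. hist s x = [] \<longleftrightarrow> x \<notin> pts s) \<and>
     (\<forall>F\<in>set (fins s). finite F \<and> F \<subseteq> isolated_points X) \<and> S (fins s) \<subseteq> cpt s"

text \<open>Cutting with \<open>A\<close> makes the bounds shrink to \<open>pt\<close>. Every point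
  of the new \<open>pts\<close>, old or fresh, receives one more move; a fresh point of
  \<open>cpt s\<close> opens its game within \<open>bound s\<close>, where the previous answer
  already confines the values.\<close>

definition state_step ::
  "'a topology \<Rightarrow> 'b topology \<Rightarrow> 'b \<Rightarrow> ('b set list \<Rightarrow> 'b set) \<Rightarrow> ('a set list \<Rightarrow> 'a set) \<Rightarrow>
    (nat \<Rightarrow> 'b set) \<Rightarrow> ('a, 'b) state \<Rightarrow> ('a \<Rightarrow> 'b) set \<Rightarrow> ('a, 'b) state \<Rightarrow> bool" where
  "state_step X Y pt \<tau> S A s U s' \<longleftrightarrow>
     good_state X Y pt \<tau> S s' \<and> answer X Y pt \<tau> s' \<subseteq> U \<and>
     cpt s \<subseteq> cpt s' \<and> pts s \<subseteq> pts s' \<and> bound s' \<subseteq> bound s \<inter> A (length (fins s)) \<and>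
     fins s' = fins s @ [pts s' - (pts s \<union> cpt s)] \<and>
     (\<forall>x\<in>pts s'. \<exists>w. hist s' x = hist s x @ [w] \<and> (x \<in> cpt s - pts s \<longrightarrow> w \<subseteq> bound s))"

lemma state_step_mono:
  assumes "state_step X Y pt \<tau> S A s U s'"
  shows "cpt s \<subseteq> cpt s'" "pts s \<subseteq> pts s'" "bound s' \<subseteq> bound s"
  using assms by (auto simp: state_step_def)

text \<open>\<open>pts s\<close> is open, so the rest of \<open>cpt s\<close> is compact and only
  finitely many subbasic conditions occur. A member arises from the constant function
  \<open>pt\<close> by changing it on the finite set \<open>pts s\<close>.\<close>

lemma answer_open_nonempty:
  assumes pt: "pt \<in> topspace Y" and \<tau>: "EN_winning_strategy_N Y \<tau>"
    and s: "good_state X Y pt \<tau> S s"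
  shows "openin (Ck' X Y pt) (answer X Y pt \<tau> s)" "answer X Y pt \<tau> s \<noteq> {}"
proof -
  let ?C = "topspace (Ck' X Y pt)"
  have fin: "finite (pts s)" and iso: "pts s \<subseteq> isolated_points X"
    using s by (auto simp: good_state_def)
  have \<tau>1: "openin Y (\<tau> (hist s x))" "\<tau> (hist s x) \<noteq> {}" if "x \<in> pts s" for x
    using s \<tau> that by (auto simp: good_state_def EN_winning_strategy_N_def)
  have "compactin X (cpt s \<inter> (topspace X - pts s))"
    using s iso openin_isolated
    by (intro compact_Int_closedin closedin_diff) (auto simp: good_state_def)
  moreover have "cpt s \<inter> (topspace X - pts s) = cpt s - pts s"
    using s compactin_subset_topspace[of X "cpt s"] by (auto simp: good_state_def)
  ultimately have "compactin X (cpt s - pts s)" by simp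
  then have 1: "openin (Ck' X Y pt) {g \<in> ?C. g ` (cpt s - pts s) \<subseteq> bound s}"
    using s by (intro openin_Ck'_subbasic) (auto simp: good_state_def)
  have 2: "openin (Ck' X Y pt) {g \<in> ?C. g ` {x} \<subseteq> \<tau> (hist s x)}" if "x \<in> pts s" for x
    using that \<tau>1 iso by (intro openin_Ck'_subbasic) (auto dest: isolated_pointsD)
  have "openin (Ck' X Y pt) (\<Inter>(insert {g \<in> ?C. g ` (cpt s - pts s) \<subseteq> bound s}
      ((\<lambda>x. {g \<in> ?C. g ` {x} \<subseteq> \<tau> (hist s x)}) ` pts s)))"
    using fin 1 2 by (intro openin_Inter) auto
  also have "\<Inter>(insert {g \<in> ?C. g ` (cpt s - pts s) \<subseteq> bound s}
      ((\<lambda>x. {g \<in> ?C. g ` {x} \<subseteq> \<tau> (hist s x)}) ` pts s)) = answer X Y pt \<tau> s"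
    by (auto simp: answer_def)
  finally show "openin (Ck' X Y pt) (answer X Y pt \<tau> s)" .
  have "\<exists>y. y \<in> \<tau> (hist s x)" if "x \<in> pts s" for x using \<tau>1 that by blast
  then obtain e where e: "\<And>x. x \<in> pts s \<Longrightarrow> e x \<in> \<tau> (hist s x)" by metis
  let ?g = "\<lambda>x. if x \<in> pts s then e x else (\<lambda>x\<in>topspace X. pt) x"
  have "?g \<in> ?C"
    using e \<tau>1 openin_subset
    by (intro modify_in_topspace_Ck'[OF const_in_topspace_Ck'[OF pt] fin iso]) blast
  moreover have "cpt s \<subseteq> topspace X" "pt \<in> bound s"
    using s compactin_subset_topspace[of X "cpt s"] by (auto simp: good_state_def)
  ultimately have "?g \<in> answer X Y pt \<tau> s" using e by (auto simp: answer_def)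
  then show "answer X Y pt \<tau> s \<noteq> {}" by blast
qed

text \<open>A box around some \<open>f\<close> in \<open>U\<close> supplies the new data. The moves
  in the games in \<open>Y\<close> are non-empty because they contain the values of
  \<open>f\<close>, which lies in the previous answer of N.\<close>

lemma state_step_exists:
  assumes pt: "pt \<in> topspace Y" and \<tau>: "EN_winning_strategy_N Y \<tau>"
    and S: "KF_winning_strategy_K X S"
    and A: "\<And>n. openin Y (A n)" "\<And>n. pt \<in> A n"
    and s: "good_state X Y pt \<tau> S s"
    and U: "openin (Ck' X Y pt) U" "U \<noteq> {}" "U \<subseteq> answer X Y pt \<tau> s"
  shows "\<exists>s'. state_step X Y pt \<tau> S A s U s'"
proof -
  have \<tau>1: "openin Y (\<tau> us)" "\<tau> us \<subseteq> last us" if "us \<noteq> []" "EN_position Y \<tau> us" for us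
    using \<tau> that by (auto simp: EN_winning_strategy_N_def)
  obtain f where f: "f \<in> U" using U by blast
  obtain K G D W where box: "is_box X Y pt f U K G D W" using box_nhd[OF pt U(1) f] by blast
  have f_ans: "f \<in> answer X Y pt \<tau> s" using f U by blast
  define D' where "D' = pts s \<union> D"
  define F where "F = D' - (pts s \<union> cpt s)"
  \<comment> \<open>\<open>W x\<close> is cut down to a legal move in a running game, to the old
    bound for a fresh point of \<open>cpt s\<close>, and not at all for other fresh points.\<close>
  define w where "w x = W x \<inter> (if x \<in> pts s then \<tau> (hist s x) else
    if x \<in> cpt s then bound s else topspace Y)" for x
  define s' where "s' = \<lparr>cpt = cpt s \<union> K \<union> S (fins s @ [F]), pts = D',
    bound = bound s \<inter> G \<inter> A (length (fins s)),
    hist = (\<lambda>x. if x \<in> D' then hist s x @ [w x] else []), fins = fins s @ [F]\<rparr>"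
  have D': "finite D'" "D' \<subseteq> isolated_points X"
    using s box by (auto simp: D'_def good_state_def is_box_def)
  have hist_s: "EN_position Y \<tau> (hist s x)" "hist s x = [] \<longleftrightarrow> x \<notin> pts s" for x
    using s by (auto simp: good_state_def)
  have w: "openin Y (w x)" "f x \<in> w x" if "x \<in> D'" for x
  proof -
    have x: "x \<in> topspace X" using that D' by (auto dest: isolated_pointsD)
    have "openin Y (W x)" "openin Y (bound s)" using x s box by (auto simp: is_box_def good_state_def)
    then show "openin Y (w x)" using \<tau>1(1)[of "hist s x"] hist_s[of x] by (simp add: w_def openin_Int)
    have "f x \<in> topspace Y" using f_ans x topspace_Ck'D(3) by (auto simp: answer_def)
    then show "f x \<in> w x"
      using f_ans box x by (auto simp: w_def is_box_def answer_def)
  qed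
  have pos: "EN_position Y \<tau> (hist s x @ [w x])" if "x \<in> D'" for x
    using w[OF that] hist_s[of x] by (auto simp: EN_position_snoc w_def)
  have Fs: "\<forall>F\<in>set (fins s'). finite F \<and> F \<subseteq> isolated_points X"
    using s D' by (auto simp: s'_def F_def good_state_def)
  then have "compactin X (S (fins s @ [F]))"
    using S by (simp add: KF_winning_strategy_K_def s'_def)
  then have good: "good_state X Y pt \<tau> S s'"
    using s box A D' pos Fs by (auto simp: good_state_def is_box_def s'_def compactin_Un)
  \<comment> \<open>On \<open>D'\<close> the answer of \<open>\<tau>\<close> lies in
    \<open>w x\<close>, hence in \<open>W x\<close>; on the rest of \<open>K\<close> the bound
    \<open>G\<close> does.\<close>
  have "g \<in> U" if g: "g \<in> answer X Y pt \<tau> s'" for g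
  proof -
    have gC: "g \<in> topspace (Ck' X Y pt)" using g by (simp add: answer_def)
    have "g x \<in> W x" if x: "x \<in> K" for x
    proof (cases "x \<in> D'")
      case True
      then have "g x \<in> \<tau> (hist s x @ [w x])" using g by (auto simp: answer_def s'_def)
      then show ?thesis using \<tau>1(2)[OF _ pos[OF True]] by (auto simp: w_def)
    next
      case False
      then have "g x \<in> G" using g x by (auto simp: answer_def s'_def)
      moreover have "x \<in> topspace X" using x box compactin_subset_topspace by (auto simp: is_box_def)
      ultimately show ?thesis using False box by (auto simp: is_box_def D'_def)
    qed
    then show ?thesis using box gC by (simp add: is_box_def)
  qed
  then have "state_step X Y pt \<tau> S A s U s'"
    using good by (auto simp: state_step_def s'_def F_def D'_def w_def)
  then show ?thesis ..
qed

section \<open>The limit of an infinite play\<close>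

text \<open>The histories at \<open>x\<close> are initial parts of a single play in \<open>Y\<close>
  against \<open>\<tau>\<close>; \<open>y\<close> is a point that survives it.\<close>

lemma state_run_point:
  assumes \<tau>: "EN_winning_strategy_N Y \<tau>"
    and good: "\<And>n. good_state X Y pt \<tau> S (s n)"
    and step: "\<And>n. state_step X Y pt \<tau> S A (s n) (U n) (s (Suc n))"
    and dom0: "pts (s 0) = {}" and x: "x \<in> (\<Union>n. pts (s n))"
  obtains k y where "x \<notin> pts (s k)" "\<And>n. x \<in> pts (s n) \<longleftrightarrow> k < n"
    "\<And>n. x \<in> pts (s n) \<Longrightarrow> y \<in> last (hist (s n) x)"
    "\<And>n. x \<in> pts (s n) \<Longrightarrow> y \<in> \<tau> (hist (s n) x)"
proof -
  \<comment> \<open>The last index at which \<open>x\<close> is still outside; the subtraction is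
    genuine because \<open>pts (s 0)\<close> is empty.\<close>
  define k where "k = (LEAST n. x \<in> pts (s n)) - 1"
  have mono: "pts (s m) \<subseteq> pts (s n)" if "m \<le> n" for m n
    using lift_Suc_mono_le[of "\<lambda>n. pts (s n)", OF state_step_mono(2)[OF step] that] .
  let ?l = "LEAST n. x \<in> pts (s n)"
  have l: "x \<in> pts (s ?l)" using x by (auto intro: LeastI)
  then have "?l \<noteq> 0" using dom0 by (metis empty_iff)
  then have kl: "?l = Suc k" by (simp add: k_def)
  have nk: "x \<notin> pts (s k)" using not_less_Least[of k "\<lambda>n. x \<in> pts (s n)"] kl by simp
  have dom_iff: "x \<in> pts (s n) \<longleftrightarrow> k < n" for n
    using nk l kl mono[of n k] mono[of "Suc k" n] by (metis Suc_leI linorder_not_le subsetD)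
  define B where "B j = last (hist (s (Suc (k + j))) x)" for j
  have hist_step: "hist (s (Suc n)) x = hist (s n) x @ [last (hist (s (Suc n)) x)]" if "k \<le> n" for n
    using step[of n] dom_iff[of "Suc n"] that by (auto simp: state_step_def)
  have B: "map B [0..<j] = hist (s (k + j)) x" for j
  proof (induction j)
    case 0
    have "hist (s k) x = []" using nk good[of k] by (simp add: good_state_def)
    then show ?case by simp
  next
    case (Suc j)
    then show ?case using hist_step[of "k + j"] by (simp add: B_def)
  qed
  have "EN_position Y \<tau> (map B [0..<j])" for j
    using good[of "k + j"] unfolding B by (simp add: good_state_def)
  then have "(\<Inter>j. B j) \<noteq> {}" using \<tau> unfolding EN_winning_strategy_N_def by blast
  then obtain y where y: "\<And>j. y \<in> B j" by blast
  have last: "y \<in> last (hist (s n) x)" if "k < n" for n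
    using y[of "n - Suc k"] that by (simp add: B_def)
  \<comment> \<open>The next move of E at \<open>x\<close> contains \<open>y\<close> and lies inside
    this answer.\<close>
  have "y \<in> \<tau> (hist (s n) x)" if n: "k < n" for n
  proof -
    have "EN_position Y \<tau> (hist (s (Suc n)) x)" using good[of "Suc n"] by (simp add: good_state_def)
    then have "EN_position Y \<tau> (hist (s n) x @ [last (hist (s (Suc n)) x)])"
      using hist_step[of n] n by simp
    moreover have "hist (s n) x \<noteq> []" using good[of n] dom_iff n by (auto simp: good_state_def)
    ultimately show ?thesis using last[of "Suc n"] n by (auto simp: EN_position_snoc)
  qed
  with that nk dom_iff last show thesis by metis
qed

text \<open>The common element takes the surviving value at each point that ever enters
  \<open>pts\<close>, and \<open>pt\<close> elsewhere. Both its continuity and its membership in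
  every answer of N rest on \<open>y_G\<close>.\<close>

lemma state_run_nonempty:
  assumes pt: "pt \<in> topspace Y" and \<tau>: "EN_winning_strategy_N Y \<tau>"
    and S: "KF_winning_strategy_K X S"
    and A: "\<And>V. openin Y V \<Longrightarrow> pt \<in> V \<Longrightarrow> \<exists>n. \<forall>m\<ge>n. A m \<subseteq> V"
    and good: "\<And>n. good_state X Y pt \<tau> S (s n)"
    and step: "\<And>n. state_step X Y pt \<tau> S A (s n) (U n) (s (Suc n))"
    and init: "pts (s 0) = {}" "fins (s 0) = []"
  shows "(\<Inter>n::nat. U n) \<noteq> {}"
proof -
  let ?D = "\<lambda>n. pts (s n)" and ?M = "\<lambda>n. cpt (s n)" and ?G = "\<lambda>n. bound (s n)"
  define F where "F n = ?D (Suc n) - (?D n \<union> ?M n)" for n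
  have fins: "fins (s n) = map F [0..<n]" for n
  proof (induction n)
    case (Suc n)
    then show ?case using step[of n] by (simp add: state_step_def F_def)
  qed (use init in simp)
  have M_mono: "?M m \<subseteq> ?M n" if "m \<le> n" for m n
    using lift_Suc_mono_le[of ?M, OF state_step_mono(1)[OF step] that] .
  have G_mono: "?G n \<subseteq> ?G m" if "m \<le> n" for m n
    using lift_Suc_antimono_le[of ?G, OF state_step_mono(3)[OF step] that] .
  have G_A: "?G (Suc n) \<subseteq> A n" for n using step[of n] by (auto simp: state_step_def fins)
  have D: "finite (?D n)" "?D n \<subseteq> isolated_points X" for n
    using good[of n] by (auto simp: good_state_def)
  have F: "finite (F n) \<and> F n \<subseteq> isolated_points X" for n using D[of "Suc n"] by (auto simp: F_def)
  have "F n \<inter> S (map F [0..<n]) = {}" for n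
    using good[of n] by (auto simp: good_state_def fins F_def)
  then have disc: "discrete_family X F" using S F by (auto simp: KF_winning_strategy_K_def)
  have "\<exists>k y. \<forall>n. (x \<in> ?D n \<longleftrightarrow> k < n) \<and>
      (k < n \<longrightarrow> y \<in> last (hist (s n) x) \<and> y \<in> \<tau> (hist (s n) x))" if "x \<in> (\<Union>n. ?D n)" for x
    using state_run_point[OF \<tau> good step init(1) that] by metis
  then obtain k y where dom_iff: "\<And>x n. x \<in> (\<Union>n. ?D n) \<Longrightarrow> x \<in> ?D n \<longleftrightarrow> k x < n"
    and y_last: "\<And>x n. x \<in> (\<Union>n. ?D n) \<Longrightarrow> k x < n \<Longrightarrow> y x \<in> last (hist (s n) x)"
    and y_\<tau>: "\<And>x n. x \<in> (\<Union>n. ?D n) \<Longrightarrow> k x < n \<Longrightarrow> y x \<in> \<tau> (hist (s n) x)"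
    by metis
  \<comment> \<open>\<open>y x\<close> lies in the opening move at \<open>x\<close>, which was cut
    down to the bound because \<open>x\<close> entered from inside the compact set.\<close>
  have y_G: "y x \<in> ?G (k x)" if x: "x \<in> (\<Union>n. ?D n)" and "x \<in> ?M (k x)" for x
  proof -
    have "x \<in> ?D (Suc (k x))" "x \<notin> ?D (k x)" using dom_iff[OF x] by auto
    then have "last (hist (s (Suc (k x))) x) \<subseteq> ?G (k x)"
      using step[of "k x"] that(2) by (fastforce simp: state_step_def)
    then show ?thesis using y_last[OF x, of "Suc (k x)"] by auto
  qed
  have DX: "(\<Union>n. ?D n) \<subseteq> isolated_points X" using D by blast
  define f where "f x = (if x \<in> (\<Union>n. ?D n) then y x else (\<lambda>x\<in>topspace X. pt) x)" for x
  have f_D: "f x = y x" if "x \<in> (\<Union>n. ?D n)" for x using that by (simp add: f_def)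
  have f_pt: "f x = pt" if "x \<in> topspace X" "x \<notin> (\<Union>n. ?D n)" for x using that by (simp add: f_def)
  have yY: "y x \<in> topspace Y" if x: "x \<in> (\<Union>n. ?D n)" for x
  proof -
    have "x \<in> ?D (Suc (k x))" using dom_iff[OF x] by simp
    then have "hist (s (Suc (k x))) x \<noteq> []" "EN_position Y \<tau> (hist (s (Suc (k x))) x)"
      using good[of "Suc (k x)"] by (auto simp: good_state_def)
    then have "openin Y (\<tau> (hist (s (Suc (k x))) x))"
      using \<tau> by (auto simp: EN_winning_strategy_N_def)
    then show ?thesis using y_\<tau>[OF x, of "Suc (k x)"] openin_subset by blast
  qed
  have fC: "f \<in> topspace (Ck' X Y pt)"
  proof (rule topspace_Ck'I)
    show "f \<in> extensional (topspace X)"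
      using DX by (auto simp: f_def extensional_def dest: isolated_pointsD)
    show "f x \<in> topspace Y" if "x \<in> topspace X" for x
      using that yY pt by (cases "x \<in> (\<Union>n. ?D n)") (simp_all add: f_D f_pt)
    show "f x = pt" if "x \<in> nonisolated_points X" for x
      using that DX by (intro f_pt) (auto simp: nonisolated_points_def)
  next
    fix x W assume x: "x \<in> nonisolated_points X" and W: "openin Y W" "pt \<in> W"
    obtain m where m: "\<And>n. n \<ge> m \<Longrightarrow> A n \<subseteq> W" using A[OF W] by blast
    have xX: "x \<in> topspace X" "x \<notin> isolated_points X" using x by (auto simp: nonisolated_points_def)
    obtain V where V: "openin X V" "x \<in> V"
      and Vd: "\<And>i j. V \<inter> F i \<noteq> {} \<Longrightarrow> V \<inter> F j \<noteq> {} \<Longrightarrow> i = j"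
      using disc xX(1) unfolding discrete_family_def by metis
    \<comment> \<open>\<open>V\<close> meets at most one \<open>F i\<close>, so the points of
      \<open>V\<close> that entered outside the compact sets are finitely many and can be
      deleted.\<close>
    have "finite (\<Union>i. V \<inter> F i)"
    proof (cases "\<exists>i. V \<inter> F i \<noteq> {}")
      case True
      then obtain i where "V \<inter> F i \<noteq> {}" by blast
      then have "(\<Union>i. V \<inter> F i) \<subseteq> F i" using Vd by blast
      then show ?thesis using F finite_subset by blast
    qed simp
    then have "closedin X (?D (Suc m) \<union> (\<Union>i. V \<inter> F i))"
      using D F by (intro closedin_finite_isolated) blast+
    then have "openin X (V - (?D (Suc m) \<union> (\<Union>i. V \<inter> F i)))" using V by blast
    moreover have "x \<in> V - (?D (Suc m) \<union> (\<Union>i. V \<inter> F i))" using V xX D F by blast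
    \<comment> \<open>A remaining \<open>z\<close> that ever enters does so after stage
      \<open>Suc m\<close> and from inside \<open>?M (k z)\<close>, so its value is in
      \<open>?G (Suc m)\<close>, which lies in \<open>A m\<close>.\<close>
    moreover have "f z \<in> W" if z: "z \<in> V - (?D (Suc m) \<union> (\<Union>i. V \<inter> F i))" for z
    proof (cases "z \<in> (\<Union>n. ?D n)")
      case True
      have "z \<notin> F (k z)" using z by blast
      then have "z \<in> ?M (k z)" using dom_iff[OF True] by (auto simp: F_def)
      then have "y z \<in> ?G (k z)" by (rule y_G[OF True])
      moreover have "Suc m \<le> k z" using z dom_iff[OF True, of "Suc m"] by simp
      ultimately have "y z \<in> A m" using G_mono[of "Suc m" "k z"] G_A[of m] by blast
      then show ?thesis using m[of m] f_D[OF True] by auto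
    next
      case False
      moreover have "z \<in> topspace X" using z openin_subset[OF V(1)] by blast
      ultimately show ?thesis using W f_pt by simp
    qed
    ultimately show "\<exists>V. openin X V \<and> x \<in> V \<and> (\<forall>y\<in>V. f y \<in> W)" by blast
  qed
  have "f \<in> answer X Y pt \<tau> (s n)" for n
  proof -
    \<comment> \<open>Such an \<open>x\<close> either enters later, from inside the larger compact
      set and hence with a value in a smaller bound, or never enters and has value
      \<open>pt\<close>.\<close>
    have "f x \<in> ?G n" if x: "x \<in> ?M n" "x \<notin> ?D n" for x
    proof (cases "x \<in> (\<Union>n. ?D n)")
      case True
      have "n \<le> k x" using dom_iff[OF True, of n] x(2) by simp
      then have "y x \<in> ?G (k x)" using M_mono x(1) by (intro y_G[OF True]) blast
      then show ?thesis using G_mono[OF \<open>n \<le> k x\<close>] f_D[OF True] by auto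
    next
      case False
      have "compactin X (?M n)" "pt \<in> ?G n" using good[of n] by (auto simp: good_state_def)
      then show ?thesis using False x compactin_subset_topspace f_pt by fastforce
    qed
    moreover have "f x \<in> \<tau> (hist (s n) x)" if "x \<in> ?D n" for x
    proof -
      have x: "x \<in> (\<Union>n. ?D n)" using that by blast
      show ?thesis using y_\<tau>[OF x] dom_iff[OF x] that f_D[OF x] by simp
    qed
    ultimately show ?thesis using fC by (auto simp: answer_def)
  qed
  then have "f \<in> U n" for n using step[of n] unfolding state_step_def by blast
  then show ?thesis by blast
qed

lemma Choquet_Ck'_if_WDMOP:
  assumes pt: "pt \<in> topspace Y" and fc: "first_countable_at Y pt"
    and Ch: "Choquet_space Y" and WD: "WDMOP X"
  shows "Choquet_space (Ck' X Y pt)"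
proof -
  obtain \<tau> where \<tau>: "EN_winning_strategy_N Y \<tau>" using Ch by (auto simp: Choquet_space_def)
  obtain S where S: "KF_winning_strategy_K X S" using WD by (auto simp: WDMOP_def)
  obtain A :: "nat \<Rightarrow> _ set" where A: "\<And>n. openin Y (A n)" "\<And>n. pt \<in> A n"
    "\<And>V. openin Y V \<Longrightarrow> pt \<in> V \<Longrightarrow> \<exists>n. \<forall>m\<ge>n. A m \<subseteq> V"
    using first_countable_at_sequence[OF fc pt] by metis
  define s0 where "s0 = \<lparr>cpt = S [], pts = {}, bound = topspace Y, hist = (\<lambda>_. []), fins = []\<rparr>"
  show ?thesis
  proof (rule Choquet_spaceI_states[where I = "good_state X Y pt \<tau> S" and ?s0.0 = s0
        and V = "answer X Y pt \<tau>" and R = "state_step X Y pt \<tau> S A"])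
    have S0: "compactin X (S [])" using S by (simp add: KF_winning_strategy_K_def)
    then show "good_state X Y pt \<tau> S s0" using pt by (auto simp: good_state_def s0_def)
    show "topspace (Ck' X Y pt) \<subseteq> answer X Y pt \<tau> s0"
      using compactin_subset_topspace[OF S0] topspace_Ck'D(3)[of _ X Y pt]
      by (auto simp: answer_def s0_def)
    show "\<exists>s'. state_step X Y pt \<tau> S A s U s'"
      if "good_state X Y pt \<tau> S s" "openin (Ck' X Y pt) U" "U \<noteq> {}" "U \<subseteq> answer X Y pt \<tau> s" for s U
      using state_step_exists[OF pt \<tau> S A(1,2) that] .
    show "good_state X Y pt \<tau> S s' \<and> openin (Ck' X Y pt) (answer X Y pt \<tau> s') \<and>
        answer X Y pt \<tau> s' \<noteq> {} \<and> answer X Y pt \<tau> s' \<subseteq> U"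
      if "state_step X Y pt \<tau> S A s U s'" for s U s'
      using that answer_open_nonempty[OF pt \<tau>, of X S s'] by (auto simp: state_step_def)
    show "(\<Inter>n. U n) \<noteq> {}"
      if "s 0 = s0" "\<And>n. good_state X Y pt \<tau> S (s n)"
        "\<And>n. state_step X Y pt \<tau> S A (s n) (U n) (s (Suc n))" for s and U :: "nat \<Rightarrow> _"
      using state_run_nonempty[where s = s and U = U, OF pt \<tau> S A(3) that(2,3)] that(1)
      by (simp add: s0_def)
  qed
qed

section \<open>The equivalence and the two-point space\<close>

lemma Choquet_Ck'_iff_WDMOP:
  assumes "pt \<in> topspace Y" "star_admissible Y pt" "first_countable_at Y pt" "Choquet_space Y"
  shows "Choquet_space (Ck' X Y pt) \<longleftrightarrow> WDMOP X"
  using WDMOP_if_Choquet_Ck'[OF assms(1,2)] Choquet_Ck'_if_WDMOP[OF assms(1,3,4)] by metis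

text \<open>N answers the first move with a singleton, after which E can only repeat it;
  \<open>None\<close> stands for no point chosen yet.\<close>

lemma Choquet_discrete_topology: "Choquet_space (discrete_topology A)"
proof (rule Choquet_spaceI_states[where I = "\<lambda>_. True" and ?s0.0 = None
      and V = "\<lambda>s. case s of None \<Rightarrow> A | Some a \<Rightarrow> {a}"
      and R = "\<lambda>s U s'. U \<subseteq> A \<and> U \<subseteq> (case s of None \<Rightarrow> A | Some a \<Rightarrow> {a}) \<and> (\<exists>a\<in>U. s' = Some a)"])
  fix s :: "nat \<Rightarrow> 'a option" and U :: "nat \<Rightarrow> 'a set"
  assume R: "\<And>n. U n \<subseteq> A \<and> U n \<subseteq> (case s n of None \<Rightarrow> A | Some a \<Rightarrow> {a}) \<and>
    (\<exists>a\<in>U n. s (Suc n) = Some a)"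
  obtain a where a: "a \<in> U 0" "s (Suc 0) = Some a" using R[of 0] by blast
  have "s (Suc n) = Some a \<and> a \<in> U n" for n
  proof (induction n)
    case (Suc n)
    then show ?case using R[of "Suc n"] by auto
  qed (use a in simp)
  then show "(\<Inter>n. U n) \<noteq> {}" by blast
qed auto

theorem theorem5p3:
  fixes X :: "'a topology" and Y :: "'b topology" and pt :: 'b
  assumes "pt \<in> topspace Y"
    and "star_admissible Y pt"
    and "first_countable_at Y pt"
    and "Choquet_space Y"
  shows "(Choquet_space (Ck' X Y pt) \<longleftrightarrow> WDMOP X) \<and>
         (WDMOP X \<longleftrightarrow> Choquet_space (Ck' X (discrete_topology {0::nat, 1}) 0))"
proof -
  let ?T = "discrete_topology {0::nat, 1}"
  have "?T closure_of {0} = {0}" by (intro closure_of_closedin) simp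
  then have "star_admissible ?T 0"
    unfolding star_admissible_def
    by (intro exI[of _ "{0}"]) auto
  moreover have "first_countable_at ?T 0"
    unfolding first_countable_at_def by (intro exI[of _ "{{0}}"]) auto
  ultimately have "Choquet_space (Ck' X ?T 0) \<longleftrightarrow> WDMOP X"
    by (intro Choquet_Ck'_iff_WDMOP Choquet_discrete_topology) auto
  then show ?thesis using Choquet_Ck'_iff_WDMOP[OF assms] by blast
qed

end
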